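(* Let $G$ be a graph on $n$ vertices and let $H$ be a symmetric $d\times d$ complex Hadamard matrix all of whose first-row and first-column entries equal $1$. Then the generalized graph state has the tensor product state (PEPS) representation $$|\psi_{G,H}\rangle\propto\prod_{s\in V(G)}\left(\sum_{i_s=0}^{d-1}|i_s\rangle\langle\underbrace{i_si_s\cdots i_s}_{m(s)}|\right)|\Psi_G\rangle,$$ where $m(s)$ is the degree of $s$ in $G$, the operator indexed by $s$ maps the $m(s)$ qudits of $|\Psi_G\rangle$ located at site $s$ to a single qudit, and $\propto$ means equality up to a nonzero scalar.
   Context: A complex Hadamard matrix of size $d$ is a $d\times d$ complex matrix $H=(h_{ij})_{i,j=0}^{d-1}$ with $|h_{ij}|=1$ for all $i,j$ and $H^\dagger H=dI_d$; it is symmetric if $H=H^T$. A qudit has state space $\mathbb{C}^d$ with computational basis $|0\rangle,\dots,|d-1\rangle$. For symmetric $H$, the generalized controlled-$Z$ gate $C^H$ is the diagonal operator on $\mathbb{C}^d\otimes\mathbb{C}^d$ with $C^H|ij\rangle=h_{ij}|ij\rangle$; $C^H_{ab}$ denotes this gate acting on qudits $a,b$. For a (finite, simple) undirected graph $G$ with vertex set $V(G)=\{1,\dots,n\}$ and edge set $E(G)$, the generalized graph state in $(\mathbb{C}^d)^{\otimes n}$ is $$|\psi_{G,H}\rangle=\mathcal{U}_{G,H}|0\rangle^{\otimes n},\qquad \mathcal{U}_{G,H}=\frac{1}{d^{n/2}}\Big(\prod_{ab\in E(G)}C^H_{ab}\Big)H^{\otimes n}.$$ The (un-normalized) bond state on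 two qudits associated with an edge $st$ is $|\psi^{\mathrm{bond}}_{st}\rangle=C^H_{st}\sum_{i_s,i_t=0}^{d-1}|i_si_t\rangle$. The state $|\Psi_G\rangle$ is defined on a system having $m(s)$ qudits at each site $s\in V(G)$, one for each edge of $G$ incident to $s$, by $|\Psi_G\rangle=\bigotimes_{st\in E(G)}|\psi^{\mathrm{bond}}_{st}\rangle$, where the bond state for edge $st$ lives on the qudit at $s$ and the qudit at $t$ associated with that edge. *)

theory Defs
  imports Complex_Main "HOL-Library.FuncSet" "Jordan_Normal_Form.Schur_Decomposition"
begin

definition complex_hadamard :: "nat \<Rightarrow> complex mat \<Rightarrow> bool" where
  "complex_hadamard d H \<longleftrightarrow>
     H \<in> carrier_mat d d \<and>
     (\<forall>i<d. \<forall>j<d. cmod (H $$ (i, j)) = 1) \<and>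
     mat_adjoint H * H = of_nat d \<cdot>\<^sub>m 1\<^sub>m d"

definition symmetric_matrix :: "complex mat \<Rightarrow> bool" where
  "symmetric_matrix H \<longleftrightarrow> transpose_mat H = H"

definition simple_graph :: "'v set \<Rightarrow> 'v set set \<Rightarrow> bool" where
  "simple_graph V E \<longleftrightarrow> finite V \<and> (\<forall>e\<in>E. e \<subseteq> V \<and> card e = 2)"

text \<open>
  Qudits are named by labels of a type \<open>'l\<close>. A computational basis vector of the qudits in a label
  set \<open>L\<close> is an assignment of a digit below \<open>d\<close> to each label in \<open>L\<close> (undefined off \<open>L\<close>), and a state
  is its family of amplitudes, equal to \<open>0\<close> off \<open>configs d L\<close>. Tensor factors are thus identified by
  label rather than by position.
\<close>

type_synonym 'l config = "'l \<Rightarrow> nat"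
type_synonym 'l state = "'l config \<Rightarrow> complex"

definition configs :: "nat \<Rightarrow> 'l set \<Rightarrow> 'l config set" where
  "configs d L = L \<rightarrow>\<^sub>E {..<d}"

definition ket :: "'l config \<Rightarrow> 'l state" where
  "ket c = (\<lambda>x. if x = c then 1 else 0)"

definition proportional :: "'l state \<Rightarrow> 'l state \<Rightarrow> bool" where
  "proportional \<phi> \<psi> \<longleftrightarrow> (\<exists>c. c \<noteq> 0 \<and> (\<forall>x. \<phi> x = c * \<psi> x))"

definition tensor_state ::
  "nat \<Rightarrow> 'i set \<Rightarrow> ('i \<Rightarrow> 'l set) \<Rightarrow> ('i \<Rightarrow> 'l state) \<Rightarrow> 'l state" where
  "tensor_state d I L \<phi> =
     (\<lambda>x. if x \<in> configs d (\<Union>i\<in>I. L i) then \<Prod>i\<in>I. \<phi> i (restrict x (L i)) else 0)"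

text \<open>
  An operator from the qudits \<open>A\<close> to the qudits \<open>B\<close> is given by its matrix in the computational bases;
  the entry \<open>K y x\<close> is \<open>\<langle>y|K|x\<rangle>\<close>, so the first argument is the output configuration.
\<close>

type_synonym ('k, 'l) op_matrix = "'k config \<Rightarrow> 'l config \<Rightarrow> complex"

definition apply_op ::
  "nat \<Rightarrow> 'l set \<Rightarrow> 'k set \<Rightarrow> ('k, 'l) op_matrix \<Rightarrow> 'l state \<Rightarrow> 'k state" where
  "apply_op d A B K \<psi> =
     (\<lambda>y. if y \<in> configs d B then \<Sum>x\<in>configs d A. K y x * \<psi> x else 0)"

text \<open>
  The tensor product of the operators \<open>K s\<close>, \<open>s \<in> I\<close>, where \<open>K s\<close> maps the qudits \<open>A s\<close> to the qudits
  \<open>B s\<close>; both families are meant to be disjoint.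
\<close>

definition tensor_op ::
  "nat \<Rightarrow> 'i set \<Rightarrow> ('i \<Rightarrow> 'l set) \<Rightarrow> ('i \<Rightarrow> 'k set) \<Rightarrow> ('i \<Rightarrow> ('k, 'l) op_matrix)
     \<Rightarrow> 'l state \<Rightarrow> 'k state" where
  "tensor_op d I A B K =
     apply_op d (\<Union>s\<in>I. A s) (\<Union>s\<in>I. B s)
       (\<lambda>y x. \<Prod>s\<in>I. K s (restrict y (B s)) (restrict x (A s)))"

definition controlled_gate :: "complex mat \<Rightarrow> 'l \<Rightarrow> 'l \<Rightarrow> 'l state \<Rightarrow> 'l state" where
  "controlled_gate H a b \<psi> = (\<lambda>x. H $$ (x a, x b) * \<psi> x)"

lemma controlled_gate_ket:
  "controlled_gate H a b (ket c) = (\<lambda>x. H $$ (c a, c b) * ket c x)"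
  by (auto simp: controlled_gate_def ket_def)

text \<open>
  The endpoints of an edge \<open>e\<close> are \<open>Min e\<close> and \<open>Max e\<close>; their order is immaterial for symmetric \<open>H\<close>.
  The gates on different edges commute, so the fold does not depend on the order of the product.
\<close>

definition edge_gates :: "complex mat \<Rightarrow> nat set set \<Rightarrow> nat state \<Rightarrow> nat state" where
  "edge_gates H E = Finite_Set.fold (\<lambda>e U. controlled_gate H (Min e) (Max e) \<circ> U) id E"

lemma comp_fun_commute_edge_gates:
  "comp_fun_commute (\<lambda>e U. controlled_gate H (Min e) (Max e) \<circ> U)"
  by unfold_locales (auto simp: fun_eq_iff controlled_gate_def)

lemma controlled_gate_commute:
  assumes "symmetric_matrix H" "H \<in> carrier_mat d d" "x a < d" "x b < d"
  shows "controlled_gate H a b \<psi> x = controlled_gate H b a \<psi> x"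
proof -
  have "H $$ (x a, x b) = transpose_mat H $$ (x a, x b)"
    using assms(1) by (simp add: symmetric_matrix_def)
  also have "\<dots> = H $$ (x b, x a)"
    using assms(2-4) by auto
  finally show ?thesis by (simp add: controlled_gate_def)
qed

definition hadamard_layer :: "nat \<Rightarrow> nat \<Rightarrow> complex mat \<Rightarrow> nat state \<Rightarrow> nat state" where
  "hadamard_layer d n H =
     tensor_op d {1..n} (\<lambda>s. {s}) (\<lambda>s. {s}) (\<lambda>s y x. H $$ (y s, x s))"

definition graph_operator ::
  "nat \<Rightarrow> nat \<Rightarrow> nat set set \<Rightarrow> complex mat \<Rightarrow> nat state \<Rightarrow> nat state" where
  "graph_operator d n E H \<psi> =
     (\<lambda>x. complex_of_real (1 / real d powr (real n / 2)) *
            edge_gates H E (hadamard_layer d n H \<psi>) x)"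

definition graph_state :: "nat \<Rightarrow> nat \<Rightarrow> nat set set \<Rightarrow> complex mat \<Rightarrow> nat state" where
  "graph_state d n E H = graph_operator d n E H (ket (\<lambda>s\<in>{1..n}. 0))"

text \<open>The label \<open>(s, e)\<close> names the qudit at site \<open>s\<close> associated with the incident edge \<open>e\<close>.\<close>

definition bond_qudits :: "nat set \<Rightarrow> (nat \<times> nat set) set" where
  "bond_qudits e = {(s, e) | s. s \<in> e}"

definition site_qudits :: "nat set set \<Rightarrow> nat \<Rightarrow> (nat \<times> nat set) set" where
  "site_qudits E s = {(s, e) | e. e \<in> E \<and> s \<in> e}"

definition degree_in :: "nat set set \<Rightarrow> nat \<Rightarrow> nat" where
  "degree_in E s = card {e \<in> E. s \<in> e}"

lemma card_site_qudits: "card (site_qudits E s) = degree_in E s"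
proof -
  have "site_qudits E s = Pair s ` {e \<in> E. s \<in> e}"
    by (auto simp: site_qudits_def)
  then show ?thesis
    by (simp add: card_image inj_on_def degree_in_def)
qed

lemma Union_bond_qudits_eq_Union_site_qudits:
  assumes "simple_graph V E"
  shows "(\<Union>e\<in>E. bond_qudits e) = (\<Union>s\<in>V. site_qudits E s)"
  using assms by (auto simp: simple_graph_def bond_qudits_def site_qudits_def)

definition bond_state :: "nat \<Rightarrow> complex mat \<Rightarrow> nat set \<Rightarrow> (nat \<times> nat set) state" where
  "bond_state d H e =
     controlled_gate H (Min e, e) (Max e, e)
       (\<lambda>x. \<Sum>c\<in>configs d (bond_qudits e). ket c x)"

definition bond_product :: "nat \<Rightarrow> nat set set \<Rightarrow> complex mat \<Rightarrow> (nat \<times> nat set) state" where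
  "bond_product d E H = tensor_state d E bond_qudits (bond_state d H)"

text \<open>The operator \<open>\<Sum>i<d. |i\<rangle>\<langle>i\<dots>i|\<close> from all qudits at site \<open>s\<close> to the single qudit \<open>s\<close>.\<close>

definition site_map ::
  "nat \<Rightarrow> nat set set \<Rightarrow> nat \<Rightarrow> (nat, nat \<times> nat set) op_matrix" where
  "site_map d E s =
     (\<lambda>y x. \<Sum>i<d. ket (\<lambda>v\<in>{s}. i) y * cnj (ket (\<lambda>q\<in>site_qudits E s. i) x))"

definition peps_state :: "nat \<Rightarrow> nat \<Rightarrow> nat set set \<Rightarrow> complex mat \<Rightarrow> nat state" where
  "peps_state d n E H =
     tensor_op d {1..n} (site_qudits E) (\<lambda>s. {s}) (site_map d E) (bond_product d E H)"

end

theory Submission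
  imports Defs
begin

text \<open>
  Both states are compared amplitude by amplitude. The column of ones turns the Hadamard layer on
  \<open>|0\<dots>0\<rangle>\<close> into the sum of all basis kets, so the graph state has amplitude
  \<open>d\<^bsup>-n/2\<^esup> \<Prod>e. h\<^bsub>y(Min e) y(Max e)\<^esub>\<close> at \<open>y\<close>. On the other side the site operators select, for each \<open>y\<close>,
  the single configuration of the bond qudits that copies the digit \<open>y s\<close> to every qudit at \<open>s\<close>,
  and the bond product has there the amplitude \<open>\<Prod>e. h\<^bsub>y(Min e) y(Max e)\<^esub>\<close>.
\<close>

lemma simple_graph_finite_edges:
  assumes "simple_graph V E"
  shows "finite E"
  using assms by (intro finite_subset[of E "Pow V"]) (auto simp: simple_graph_def)

lemma ket_commute: "ket c x = ket x c"
  by (auto simp: ket_def)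

lemma cnj_ket [simp]: "cnj (ket c x) = ket c x"
  by (simp add: ket_def)

lemma finite_configs: "finite L \<Longrightarrow> finite (configs d L)"
  by (simp add: configs_def finite_PiE)

lemma restrict_configs:
  assumes "x \<in> configs d L" "M \<subseteq> L"
  shows "restrict x M \<in> configs d M"
  using assms by (auto simp: configs_def)

lemma sum_ket_mult:
  assumes "finite A"
  shows "(\<Sum>x\<in>A. f x * ket c x) = (if c \<in> A then f c else 0)"
proof -
  have "(\<Sum>x\<in>A. f x * ket c x) = (\<Sum>x\<in>A. if x = c then f x else 0)"
    by (intro sum.cong) (auto simp: ket_def)
  then show ?thesis using assms by simp
qed

lemma prod_ket:
  assumes "finite I"
  shows "(\<Prod>i\<in>I. ket (c i) (x i)) = (if \<forall>i\<in>I. x i = c i then 1 else 0)"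
  using assms by (induction rule: finite_induct) (auto simp: ket_def)

text \<open>The pieces \<open>A s\<close> cover every label, and off their union both configurations
  are \<open>undefined\<close>. This is what later merges the local conditions at the sites into one
  global condition.\<close>

lemma restrict_eq_all_iff:
  assumes "x \<in> configs d (\<Union>s\<in>I. A s)" "z \<in> configs d (\<Union>s\<in>I. A s)"
  shows "(\<forall>s\<in>I. restrict x (A s) = restrict z (A s)) \<longleftrightarrow> x = z"
proof
  assume eq: "\<forall>s\<in>I. restrict x (A s) = restrict z (A s)"
  have "x q = z q" if "s \<in> I" "q \<in> A s" for s q
    using eq that by (metis restrict_apply')
  then show "x = z"
    using assms unfolding configs_def by (intro PiE_ext[OF assms[unfolded configs_def]]) auto
qed simp

text \<open>Every gate is diagonal, so each one only multiplies the amplitude at \<open>x\<close> by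
  one entry of \<open>H\<close>.\<close>

lemma edge_gates_apply:
  assumes "finite E"
  shows "edge_gates H E \<psi> x = (\<Prod>e\<in>E. H $$ (x (Min e), x (Max e))) * \<psi> x"
  using assms
proof (induction E rule: finite_induct)
  case empty
  then show ?case by (simp add: edge_gates_def)
next
  case (insert e E)
  interpret comp_fun_commute "\<lambda>e U. controlled_gate H (Min e) (Max e) \<circ> U"
    by (rule comp_fun_commute_edge_gates)
  have "edge_gates H (insert e E) = controlled_gate H (Min e) (Max e) \<circ> edge_gates H E"
    unfolding edge_gates_def using insert.hyps by (rule fold_insert)
  then show ?case
    using insert by (simp add: controlled_gate_def)
qed

lemma hadamard_layer_ket_zero:
  assumes "d \<ge> 1" "\<And>i. i < d \<Longrightarrow> H $$ (i, 0) = 1"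
  shows "hadamard_layer d n H (ket (\<lambda>s\<in>{1..n}. 0)) y = (if y \<in> configs d {1..n} then 1 else 0)"
proof (cases "y \<in> configs d {1..n}")
  case True
  \<comment> \<open>As \<open>d \<ge> 1\<close>, the digit 0 is admissible, so the sum over inputs
    in \<open>apply_op\<close> contains the input ket.\<close>
  have zero: "(\<lambda>s\<in>{1..n}. 0) \<in> configs d {1..n}"
    using assms(1) by (auto simp: configs_def)
  have "H $$ (y s, 0) = 1" if "s \<in> {1..n}" for s
    using True that by (intro assms(2)) (auto simp: configs_def)
  then show ?thesis
    using True zero
    by (simp add: hadamard_layer_def tensor_op_def apply_op_def sum_ket_mult finite_configs)
qed (simp add: hadamard_layer_def tensor_op_def apply_op_def)

lemma graph_state_apply:
  assumes "finite E" "d \<ge> 1" "\<And>i. i < d \<Longrightarrow> H $$ (i, 0) = 1"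
  shows "graph_state d n E H y =
    (if y \<in> configs d {1..n}
     then complex_of_real (1 / real d powr (real n / 2)) * (\<Prod>e\<in>E. H $$ (y (Min e), y (Max e)))
     else 0)"
  using assms
  by (simp add: graph_state_def graph_operator_def edge_gates_apply hadamard_layer_ket_zero
      del: One_nat_def)

text \<open>Fixing the output digit leaves only the term \<open>i = y s\<close> of the sum. At an
  isolated vertex the remaining ket is that of the empty configuration.\<close>

lemma site_map_apply:
  assumes "y s < d"
  shows "site_map d E s (restrict y {s}) x = ket (\<lambda>q\<in>site_qudits E s. y s) x"
proof -
  have "ket (\<lambda>v\<in>{s}. i) (restrict y {s}) = (if i = y s then 1 else 0)" for i
    by (auto simp: ket_def restrict_def fun_eq_iff)
  then have "site_map d E s (restrict y {s}) x =
      (\<Sum>i<d. if i = y s then ket (\<lambda>q\<in>site_qudits E s. i) x else 0)"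
    unfolding site_map_def by (intro sum.cong) auto
  then show ?thesis
    using assms by simp
qed

lemma bond_state_apply:
  assumes "finite e" "x \<in> configs d (bond_qudits e)"
  shows "bond_state d H e x = H $$ (x (Min e, e), x (Max e, e))"
proof -
  have "bond_qudits e = (\<lambda>s. (s, e)) ` e"
    by (auto simp: bond_qudits_def)
  then have "finite (configs d (bond_qudits e))"
    using assms(1) by (simp add: finite_configs)
  \<comment> \<open>Exactly one summand, \<open>c = x\<close>, is nonzero: before the gate acts,
    every amplitude of the bond is 1.\<close>
  then have "(\<Sum>c\<in>configs d (bond_qudits e). ket c x) = 1"
    using assms(2) sum_ket_mult[of _ "\<lambda>_. 1" x] by (simp add: ket_commute[of _ x])
  then show ?thesis
    by (simp add: bond_state_def controlled_gate_def)
qed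

text \<open>Since \<open>fst q\<close> is the site of the qudit \<open>q\<close>, both qudits of an
  edge carry the digits that \<open>y\<close> gives to its endpoints.\<close>

lemma bond_product_copy:
  assumes "simple_graph V E" "y \<in> configs d V"
  shows "bond_product d E H (\<lambda>q\<in>(\<Union>s\<in>V. site_qudits E s). y (fst q)) =
    (\<Prod>e\<in>E. H $$ (y (Min e), y (Max e)))"
proof -
  let ?Q = "\<Union>s\<in>V. site_qudits E s"
  let ?z = "\<lambda>q\<in>?Q. y (fst q)"
  have Q: "(\<Union>e\<in>E. bond_qudits e) = ?Q"
    by (rule Union_bond_qudits_eq_Union_site_qudits[OF assms(1)])
  have z: "?z \<in> configs d ?Q"
    using assms(2) by (auto simp: configs_def site_qudits_def)
  have "bond_state d H e (restrict ?z (bond_qudits e)) = H $$ (y (Min e), y (Max e))"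
    if e: "e \<in> E" for e
  proof -
    have sub: "bond_qudits e \<subseteq> ?Q"
      using Q e by blast
    \<comment> \<open>An edge has two elements, so \<open>Min e\<close> and \<open>Max e\<close>
      really are members of it.\<close>
    have fin: "finite e" and "e \<noteq> {}"
      using assms(1) e by (auto simp: simple_graph_def intro: card_ge_0_finite)
    then have "(Min e, e) \<in> bond_qudits e" "(Max e, e) \<in> bond_qudits e"
      by (auto simp: bond_qudits_def)
    with sub show ?thesis
      by (subst bond_state_apply[OF fin restrict_configs[OF z sub]]) (simp add: subset_iff)
  qed
  then show ?thesis
    using z by (simp add: bond_product_def tensor_state_def Q)
qed

lemma peps_state_apply:
  assumes "simple_graph {1..n} E"
  shows "peps_state d n E H y =
    (if y \<in> configs d {1..n} then \<Prod>e\<in>E. H $$ (y (Min e), y (Max e)) else 0)"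
proof (cases "y \<in> configs d {1..n}")
  case True
  let ?Q = "\<Union>s\<in>{1..n}. site_qudits E s"
  let ?z = "\<lambda>q\<in>?Q. y (fst q)"
  have z: "?z \<in> configs d ?Q"
    using True by (auto simp: configs_def site_qudits_def)
  have "finite E"
    using assms by (rule simple_graph_finite_edges)
  then have "finite ?Q"
    by (auto simp: site_qudits_def)
  then have fin: "finite (configs d ?Q)"
    by (rule finite_configs)
  \<comment> \<open>The constant configurations at the sites are all restrictions of the single
    configuration \<open>?z\<close>, so \<open>restrict_eq_all_iff\<close> can glue them.\<close>
  have copy: "(\<lambda>q\<in>site_qudits E s. y s) = restrict ?z (site_qudits E s)" if "s \<in> {1..n}" for s
    using that by (auto simp: fun_eq_iff site_qudits_def)
  have sel: "(\<Prod>s\<in>{1..n}. site_map d E s (restrict y {s}) (restrict x (site_qudits E s))) = ket ?z x"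
    if x: "x \<in> configs d ?Q" for x
  proof -
    have "(\<Prod>s\<in>{1..n}. site_map d E s (restrict y {s}) (restrict x (site_qudits E s))) =
        (\<Prod>s\<in>{1..n}. ket (restrict ?z (site_qudits E s)) (restrict x (site_qudits E s)))"
    proof (rule prod.cong)
      fix s assume s: "s \<in> {1..n}"
      then have "y s < d"
        using True by (auto simp: configs_def)
      then show "site_map d E s (restrict y {s}) (restrict x (site_qudits E s)) =
          ket (restrict ?z (site_qudits E s)) (restrict x (site_qudits E s))"
        unfolding copy[OF s, symmetric] by (rule site_map_apply)
    qed simp
    also have "\<dots> = ket ?z x"
      unfolding prod_ket[OF finite_atLeastAtMost] restrict_eq_all_iff[OF x z] by (simp add: ket_def)
    finally show ?thesis .
  qed
  have "peps_state d n E H y = (\<Sum>x\<in>configs d ?Q. bond_product d E H x * ket ?z x)"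
    using True sel by (simp add: peps_state_def tensor_op_def apply_op_def mult.commute)
  also have "\<dots> = bond_product d E H ?z"
    using z fin by (simp only: sum_ket_mult if_True)
  also have "\<dots> = (\<Prod>e\<in>E. H $$ (y (Min e), y (Max e)))"
    by (rule bond_product_copy[OF assms True])
  finally show ?thesis
    using True by simp
qed (simp add: peps_state_def tensor_op_def apply_op_def)

theorem proposition7:
  fixes n d :: nat and E :: "nat set set" and H :: "complex mat"
  assumes "simple_graph {1..n} E"
    and "d \<ge> 1"
    and "complex_hadamard d H"
    and "symmetric_matrix H"
    and "\<And>j. j < d \<Longrightarrow> H $$ (0, j) = 1"
    and "\<And>i. i < d \<Longrightarrow> H $$ (i, 0) = 1"
  shows "proportional (graph_state d n E H) (peps_state d n E H)"
proof -
  \<comment> \<open>The scalar is the normalisation of the graph state, which the PEPS side lacks;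
    off \<open>configs d {1..n}\<close> both amplitudes are 0.\<close>
  let ?c = "complex_of_real (1 / real d powr (real n / 2))"
  have "finite E"
    using assms(1) by (rule simple_graph_finite_edges)
  then have "graph_state d n E H y = ?c * peps_state d n E H y" for y
    using assms by (simp add: graph_state_apply peps_state_apply)
  moreover have "?c \<noteq> 0"
    using assms(2) by simp
  ultimately show ?thesis
    unfolding proportional_def by blast
qed

end
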